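(* Let $1<p<\infty$. Fix a cube $Q_0\subset\mathbb{R}^n$ and let $\mathbb{B}_{Q_0}=\{B_Q\}_{Q\in\mathcal{D}(Q_0)}$ be a local oscillation with constant $C_{\mathbb{B}}$. There is a constant $C$, depending only on $n$, $p$ and $C_{\mathbb{B}}$, such that for every $Q\in\mathcal{D}(Q_0)$ and every $f\in L^1(Q)$ (extended by zero to $Q_0$), $$\|B_Qf\|_{L^{p,\infty},Q}\le C\,\|f\|_{JN^{\rm dyadic}_{\mathbb{B}_{Q_0},p},\,Q}.$$
   Context: Cubes in $\mathbb{R}^n$ have sides parallel to the axes and are half-open. $\mathcal{D}(Q_0)$ is the family of dyadic subcubes of $Q_0$ (including $Q_0$), and $\mathcal D(Q)$ is defined likewise. $|E|$ is Lebesgue measure. A family $\mathbb{B}_{Q_0}=\{B_Q\}_{Q\in\mathcal{D}(Q_0)}$ is a local oscillation, with constant $C_{\mathbb{B}}$, if, setting $A_Q:=I-B_Q$: (a) for every $Q\in\mathcal{D}(Q_0)$, $A_Q$ is a linear operator acting on functions in $L^1(Q_0)$ (with values in measurable functions on $Q_0$); (b) for every $Q\in\mathcal{D}(Q_0)$ and $f\in L^1(Q_0)$, $\|A_Qf\|_{L^\infty(Q)}\le C_{\mathbb{B}}\frac1{|Q|}\int_Q|f|\,dy$; (c) for all $Q_1\subset Q_2$ in $\mathcal{D}(Q_0)$ and $f\in L^1(Q_0)$, $B_{Q_1}A_{Q_2}f=0$ a.e. in $Q_1$ (equivalently $A_{Q_1}A_{Q_2}f=A_{Q_2}f$ a.e.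 in $Q_1$). By (a) and (b), $A_Qf$ restricted to $Q$ depends only on $f|_Q$, so in (c) $A_{Q_2}f$ may be replaced by the bounded function $(A_{Q_2}f)\chi_{Q_2}$, and this is how the composition is understood. For $Q\in\mathcal{D}(Q_0)$, $$\|f\|_{JN^{\rm dyadic}_{\mathbb{B}_{Q_0},p},\,Q}:=\sup\Big(\frac1{|Q|}\sum_i\Big(\frac1{|Q_i|}\int_{Q_i}|B_{Q_i}f|\,dx\Big)^p|Q_i|\Big)^{1/p},$$ the supremum being over all pairwise disjoint families $\{Q_i\}_i\subset\mathcal{D}(Q)$; it may be $+\infty$. $\|f\|_{L^{p,\infty},Q}=\sup_{\lambda>0}\lambda\big(|\{x\in Q:|f(x)|>\lambda\}|/|Q|\big)^{1/p}$. *)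

theory Defs
  imports "HOL-Analysis.Analysis" "HOL-Probability.Essential_Supremum"
begin

text \<open>
  Functions take values in a complete real normed field \<open>'b\<close>; this covers exactly the real and
  the complex scalars.  A function on a cube is represented by a total function whose values off
  the cube are irrelevant.
\<close>

definition hcube :: "real^'n \<Rightarrow> real \<Rightarrow> (real^'n) set" where
  "hcube a l = {x. \<forall>i. a $ i \<le> x $ i \<and> x $ i < a $ i + l}"

definition is_cube :: "(real^'n) set \<Rightarrow> bool" where
  "is_cube Q \<longleftrightarrow> (\<exists>a l. 0 < l \<and> Q = hcube a l)"

text \<open>
  The corner and the side length of a half-open cube are determined by the set, so the
  existential quantifiers over \<open>a\<close> and \<open>l\<close> only recover them.
\<close>

definition dyadic :: "(real^'n) set \<Rightarrow> (real^'n) set set" where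
  "dyadic Q = {R. \<exists>a l (k::nat) (m::'n \<Rightarrow> nat). 0 < l \<and> Q = hcube a l \<and> (\<forall>i. m i < 2 ^ k) \<and>
      R = hcube (\<chi> i. a $ i + real (m i) * (l / 2 ^ k)) (l / 2 ^ k)}"

definition L1 :: "(real^'n) set \<Rightarrow> (real^'n \<Rightarrow> 'b::{real_normed_field,banach,second_countable_topology}) set" where
  "L1 Q = {f. integrable (lebesgue_on Q) f}"

definition Linf_norm :: "(real^'n) set \<Rightarrow> (real^'n \<Rightarrow> 'b::real_normed_vector) \<Rightarrow> ereal" where
  "Linf_norm Q f = esssup (lebesgue_on Q) (\<lambda>x. ereal (norm (f x)))"

definition avg :: "(real^'n) set \<Rightarrow> (real^'n \<Rightarrow> 'b::real_normed_vector) \<Rightarrow> real" where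
  "avg Q f = (1 / measure lebesgue Q) * (LINT x|lebesgue_on Q. norm (f x))"

definition cutoff :: "(real^'n) set \<Rightarrow> (real^'n \<Rightarrow> 'b::real_normed_vector) \<Rightarrow> (real^'n \<Rightarrow> 'b)" where
  "cutoff Q f = (\<lambda>x. indicator Q x *\<^sub>R f x)"

text \<open>
  \<open>L\<^sup>1(Q\<^sub>0)\<close> and the measurable functions on \<open>Q\<^sub>0\<close> are spaces of classes modulo equality almost
  everywhere: hence well-definedness on classes is part of being an operator, and linearity
  is understood almost everywhere.
\<close>

definition linear_L1_operator ::
  "(real^'n) set \<Rightarrow> ((real^'n \<Rightarrow> 'b::{real_normed_field,banach,second_countable_topology}) \<Rightarrow> (real^'n \<Rightarrow> 'b)) \<Rightarrow> bool" where
  "linear_L1_operator Q0 T \<longleftrightarrow>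
     (\<forall>f\<in>L1 Q0. T f \<in> borel_measurable (lebesgue_on Q0)) \<and>
     (\<forall>f\<in>L1 Q0. \<forall>g\<in>L1 Q0. (AE x in lebesgue_on Q0. f x = g x) \<longrightarrow>
        (AE x in lebesgue_on Q0. T f x = T g x)) \<and>
     (\<forall>f\<in>L1 Q0. \<forall>g\<in>L1 Q0. AE x in lebesgue_on Q0. T (\<lambda>y. f y + g y) x = T f x + T g x) \<and>
     (\<forall>f\<in>L1 Q0. \<forall>c. AE x in lebesgue_on Q0. T (\<lambda>y. c * f y) x = c * T f x)"

definition A_of ::
  "((real^'n) set \<Rightarrow> (real^'n \<Rightarrow> 'b::real_normed_vector) \<Rightarrow> (real^'n \<Rightarrow> 'b)) \<Rightarrow>
   (real^'n) set \<Rightarrow> (real^'n \<Rightarrow> 'b) \<Rightarrow> (real^'n \<Rightarrow> 'b)" where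
  "A_of B Q f = (\<lambda>x. f x - B Q f x)"

text \<open>
  \<open>A_of B Q2 f\<close> need not be integrable on \<open>Q0 - Q2\<close>; it is therefore cut off to \<open>Q2\<close>, where it is
  bounded, before \<open>B Q1\<close> is applied to it.
\<close>

definition local_oscillation ::
  "(real^'n) set \<Rightarrow> ((real^'n) set \<Rightarrow> (real^'n \<Rightarrow> 'b::{real_normed_field,banach,second_countable_topology}) \<Rightarrow> (real^'n \<Rightarrow> 'b))
    \<Rightarrow> real \<Rightarrow> bool" where
  "local_oscillation Q0 B CB \<longleftrightarrow>
     (\<forall>Q\<in>dyadic Q0. linear_L1_operator Q0 (A_of B Q)) \<and>
     (\<forall>Q\<in>dyadic Q0. \<forall>f\<in>L1 Q0. Linf_norm Q (A_of B Q f) \<le> ereal (CB * avg Q f)) \<and>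
     (\<forall>Q1\<in>dyadic Q0. \<forall>Q2\<in>dyadic Q0. Q1 \<subseteq> Q2 \<longrightarrow>
        (\<forall>f\<in>L1 Q0. AE x in lebesgue_on Q1. B Q1 (cutoff Q2 (A_of B Q2 f)) x = 0))"

definition enn_root :: "real \<Rightarrow> ennreal \<Rightarrow> ennreal" where
  "enn_root p x = (if x = \<infinity> then \<infinity> else ennreal (enn2real x powr (1 / p)))"

text \<open>
  Each \<open>B R f\<close> is integrable on \<open>R\<close> when \<open>B\<close> is a local oscillation and \<open>f \<in> L1 Q0\<close>, so the
  averages are finite; the sum over the (countable, possibly infinite) family \<open>F\<close> may be infinite.
\<close>

definition JN_norm ::
  "((real^'n) set \<Rightarrow> (real^'n \<Rightarrow> 'b::real_normed_vector) \<Rightarrow> (real^'n \<Rightarrow> 'b)) \<Rightarrow> real \<Rightarrow>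
   (real^'n) set \<Rightarrow> (real^'n \<Rightarrow> 'b) \<Rightarrow> ennreal" where
  "JN_norm B p Q f = (SUP F\<in>{F. F \<subseteq> dyadic Q \<and> disjoint F}.
     enn_root p (ennreal (1 / measure lebesgue Q) *
       (\<Sum>\<^sub>\<infinity>R\<in>F. ennreal (avg R (B R f) powr p * measure lebesgue R))))"

definition weak_Lp_norm :: "real \<Rightarrow> (real^'n) set \<Rightarrow> (real^'n \<Rightarrow> 'b::real_normed_vector) \<Rightarrow> ennreal" where
  "weak_Lp_norm p Q f = (SUP t\<in>{0<..}.
     ennreal (t * (measure lebesgue {x\<in>Q. norm (f x) > t} / measure lebesgue Q) powr (1 / p)))"

end

(*
  Put g = B_Q f on Q. Since g differs from f by A_Q f, which B_R annihilates on every R in D(Q),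
  we have B_R f = g - A_R g on R, so |g| <= c avg_R |g| + |B_R f| a.e. on R.
  Apply this on the maximal dyadic cubes R with avg_R |g| > s: their averages are at most 2^n s,
  which gives a good-lambda inequality between the cubes of level s and those of level N s with
  N = 2^(n+1) c. Its right-hand side is the sum of avg_R |B_R f| |R| over disjoint cubes, and so is
  controlled by the JN norm; iterating over the levels N^k K yields the weak-type bound.
*)
theory Submission
  imports Defs
begin

text \<open>All levels start from a positive real K that bounds the JN norm. The family {Q} gives
  avg_Q |g| \<le> K, so at a level s \<ge> K the cube Q is never selected and each maximal cube has
  a parent whose average is at most s; this is the source of the factor 2^n. If V is the union of
  cubes of level N s, the choice of N makes the error c 2^n s |V| exactly half of N s |V|. The
  obstacle is that g is only known to be integrable, so no weak norm of it can be assumed finite and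
  absorbed. Instead a recursion with factor 1/2 is run upward from level K, where |V| \<le> |Q| is
  trivial. The averages of |B_R f| enter it to the first power; splitting them at a small multiple
  of s turns them into the p-th powers of the JN norm, at the price of a small multiple of the
  measure of the preceding level, and this gives the factor 1/2. The recursion speaks of unions of
  finite disjoint families of cubes only, so all sums and integrals split freely. The superlevel
  sets of g itself appear at the end, through a covering argument that costs a factor 2 in the
  level.\<close>

section \<open>Half-open cubes and their dyadic subcubes\<close>

text \<open>The corner is the coordinatewise least point of the cube, and a diagonal shift of it by
  the smaller side tells unequal sides apart. It identifies the corner and side quantified in
  \<open>dyadic\<close> with given ones.\<close>

lemma hcube_inject:
  fixes a a' :: "real^'n"
  assumes "0 < l" "0 < l'" "hcube a l = hcube a' l'"
  shows "a = a'" "l = l'"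
proof -
  have le: "a' $ i \<le> a $ i" if "0 < l" "hcube a l \<subseteq> hcube a' l'" for a a' :: "real^'n" and l l' i
  proof -
    have "a \<in> hcube a l" using that by (simp add: hcube_def)
    then show ?thesis using that by (auto simp: hcube_def)
  qed
  have "a $ i = a' $ i" for i
    using le[of l a a' l' i] le[of l' a' a l i] assms by simp
  then show "a = a'" by (simp add: vec_eq_iff)
  have le2: "l \<le> l'" if "0 < l" "0 < l'" "hcube a l \<subseteq> hcube a l'" for a :: "real^'n" and l l'
  proof (rule ccontr)
    assume "\<not> l \<le> l'"
    then have "(\<chi> i. a $ i + l') \<in> hcube a l" using that by (simp add: hcube_def)
    then have "(\<chi> i. a $ i + l') \<in> hcube a l'" using that by blast
    then show False by (simp add: hcube_def)
  qed
  show "l = l'"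
    using le2[of l l' a] le2[of l' l a] assms \<open>a = a'\<close> by simp
qed

lemma hcube_borel: "hcube a l \<in> sets borel"
proof -
  have "hcube a l = (\<Inter>i. {x. a $ i \<le> x $ i} \<inter> {x. x $ i < a $ i + l})"
    by (auto simp: hcube_def)
  also have "\<dots> \<in> sets borel"
    by (intro sets.finite_INT sets.Int borel_closed borel_open
        closed_halfspace_component_ge_cart open_halfspace_component_lt_cart) auto
  finally show ?thesis .
qed

lemma hcube_lmeasurable: "hcube a l \<in> lmeasurable"
proof (rule fmeasurableI2)
  show "cbox a (\<chi> i. a $ i + l) \<in> lmeasurable" by simp
  show "hcube a l \<subseteq> cbox a (\<chi> i. a $ i + l)" by (auto simp: hcube_def mem_box_cart less_imp_le)
  show "hcube a l \<in> sets lebesgue" using hcube_borel[of a l] by auto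
qed

lemma measure_hcube:
  fixes a :: "real^'n"
  assumes "0 < l"
  shows "measure lebesgue (hcube a l) = l ^ CARD('n)"
proof -
  define b where "b = (\<chi> i. a $ i + l)"
  have c: "measure lebesgue (cbox a b) = l ^ CARD('n)"
    using assms by (simp add: content_cbox_if_cart b_def interval_eq_empty_cart not_less)
  have "measure lebesgue (box a b) \<le> measure lebesgue (hcube a l)"
    using hcube_lmeasurable by (intro measure_mono_fmeasurable) (auto simp: hcube_def mem_box_cart b_def less_imp_le)
  moreover have "measure lebesgue (hcube a l) \<le> measure lebesgue (cbox a b)"
    using hcube_lmeasurable by (intro measure_mono_fmeasurable) (auto simp: hcube_def mem_box_cart b_def less_imp_le)
  moreover have "measure lebesgue (box a b) = measure lebesgue (cbox a b)"
    by (simp add: measure_lborel_box_eq measure_lborel_cbox_eq)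
  ultimately show ?thesis using c by simp
qed

text \<open>For \<open>x\<close> in \<open>hcube a l\<close> this is the dyadic cube of generation \<open>k\<close> containing \<open>x\<close>; described
  by floors, nestedness of the cubes becomes integer division by powers of two.\<close>

definition dcell :: "real^'n \<Rightarrow> real \<Rightarrow> nat \<Rightarrow> real^'n \<Rightarrow> (real^'n) set" where
  "dcell a l k x = {y. \<forall>i. \<lfloor>(y $ i - a $ i) * 2 ^ k / l\<rfloor> = \<lfloor>(x $ i - a $ i) * 2 ^ k / l\<rfloor>}"

lemma dcell_self: "x \<in> dcell a l k x"
  by (simp add: dcell_def)

lemma dcell_cong: "y \<in> dcell a l k x \<Longrightarrow> dcell a l k y = dcell a l k x"
  by (auto simp: dcell_def)

lemma floor_coarsen:
  fixes u :: real
  assumes "j \<le> k"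
  shows "\<lfloor>u * 2 ^ j / l\<rfloor> = \<lfloor>u * 2 ^ k / l\<rfloor> div 2 ^ (k - j)"
proof -
  have "u * 2 ^ j / l = (u * 2 ^ k / l) / of_int (2 ^ (k - j))"
    using assms by (auto simp: le_iff_add power_add)
  then show ?thesis by (metis floor_divide_real_eq_div zero_le_numeral zero_le_power)
qed

lemma dcell_mono: "j \<le> k \<Longrightarrow> dcell a l k x \<subseteq> dcell a l j x"
  unfolding dcell_def by (auto simp: floor_coarsen[of j k])

lemma dcell_nested: "j \<le> k \<Longrightarrow> y \<in> dcell a l k x \<Longrightarrow> dcell a l j y = dcell a l j x"
  using dcell_mono dcell_cong by blast

lemma dcell_eq_hcube:
  fixes a :: "real^'n"
  assumes "0 < l"
  shows "dcell a l k x
    = hcube (\<chi> i. a $ i + of_int \<lfloor>(x $ i - a $ i) * 2 ^ k / l\<rfloor> * (l / 2 ^ k)) (l / 2 ^ k)"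
proof -
  have *: "\<lfloor>u * 2 ^ k / l\<rfloor> = m \<longleftrightarrow> of_int m * (l / 2 ^ k) \<le> u \<and> u < of_int m * (l / 2 ^ k) + l / 2 ^ k" for u m
  proof -
    have "of_int m \<le> u * 2 ^ k / l \<longleftrightarrow> of_int m * (l / 2 ^ k) \<le> u"
      "u * 2 ^ k / l < of_int m + 1 \<longleftrightarrow> u < (of_int m + 1) * (l / 2 ^ k)"
      using assms by (simp_all add: field_simps)
    then show ?thesis unfolding floor_eq_iff by (simp only: distrib_right mult_1)
  qed
  show ?thesis
    unfolding dcell_def hcube_def * le_diff_eq diff_less_eq by (simp add: add_ac)
qed

lemma dcell_0:
  assumes "0 < l" "x \<in> hcube a l"
  shows "dcell a l 0 x = hcube a l"
proof -
  have "\<lfloor>(x $ i - a $ i) * 2 ^ 0 / l\<rfloor> = 0" for i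
    using assms by (auto simp: floor_eq_iff hcube_def algebra_simps)
  then show ?thesis using assms by (simp add: dcell_eq_hcube)
qed

text \<open>A point of the cell replaces the index vector \<open>m\<close>: the corner of a dyadic
  cube serves as \<open>x\<close>, and conversely the floors of the rescaled coordinates of
  \<open>x\<close> serve as \<open>m\<close>. The range of \<open>m\<close> corresponds to
  \<open>x \<in> hcube a l\<close>.\<close>

lemma dyadic_hcube:
  fixes a :: "real^'n"
  assumes l: "0 < l"
  shows "dyadic (hcube a l) = {dcell a l k x |k x. x \<in> hcube a l}"
proof (intro set_eqI iffI)
  fix R assume "R \<in> dyadic (hcube a l)"
  then obtain a' l' k and m :: "'n \<Rightarrow> nat" where h: "0 < l'" "hcube a l = hcube a' l'" "\<And>i. m i < 2 ^ k"
     "R = hcube (\<chi> i. a' $ i + real (m i) * (l' / 2 ^ k)) (l' / 2 ^ k)"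
    unfolding dyadic_def by blast
  then have [simp]: "a' = a" "l' = l" using hcube_inject[OF l, of l' a a'] by auto
  define x where "x = (\<chi> i. a $ i + real (m i) * (l / 2 ^ k))"
  have "\<lfloor>(x $ i - a $ i) * 2 ^ k / l\<rfloor> = int (m i)" for i using l by (simp add: x_def)
  then have "dcell a l k x = R" using h l by (simp add: dcell_eq_hcube)
  moreover have "x \<in> hcube a l"
    using l h(3) by (auto simp: hcube_def x_def field_simps)
  ultimately show "R \<in> {dcell a l k x |k x. x \<in> hcube a l}" by blast
next
  fix R assume "R \<in> {dcell a l k x |k x. x \<in> hcube a l}"
  then obtain k x where x: "x \<in> hcube a l" and R: "R = dcell a l k x" by blast
  define m where "m = (\<lambda>i. nat \<lfloor>(x $ i - a $ i) * 2 ^ k / l\<rfloor>)"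
  have nn: "0 \<le> (x $ i - a $ i) * 2 ^ k / l" for i using x l by (auto simp: hcube_def)
  have m: "real (m i) = of_int \<lfloor>(x $ i - a $ i) * 2 ^ k / l\<rfloor>" for i
    using nn[of i] by (simp add: m_def)
  have "m i < 2 ^ k" for i
  proof -
    have "(x $ i - a $ i) / l < 1" using x l by (auto simp: hcube_def field_simps)
    then have "(x $ i - a $ i) * 2 ^ k / l < 2 ^ k" using mult_strict_right_mono[of _ 1 "2 ^ k :: real"] by fastforce
    then have "real (m i) < 2 ^ k" unfolding m by linarith
    then show ?thesis by (metis of_nat_less_numeral_power_cancel_iff)
  qed
  then show "R \<in> dyadic (hcube a l)"
    unfolding dyadic_def R using l m by (auto simp: dcell_eq_hcube intro!: exI[of _ a] exI[of _ l] exI[of _ k] exI[of _ m])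
qed

lemma dcell_in_dyadic: "0 < l \<Longrightarrow> x \<in> hcube a l \<Longrightarrow> dcell a l k x \<in> dyadic (hcube a l)"
  unfolding dyadic_hcube by auto

lemma dyadic_self: "is_cube Q \<Longrightarrow> Q \<in> dyadic Q"
proof -
  assume "is_cube Q"
  then obtain a l where "0 < l" "Q = hcube a l" unfolding is_cube_def by blast
  moreover from this have a: "a \<in> hcube a l" by (simp add: hcube_def)
  ultimately have "dcell a l 0 a \<in> dyadic Q" "dcell a l 0 a = Q"
    unfolding \<open>Q = hcube a l\<close> dyadic_hcube[OF \<open>0 < l\<close>] using dcell_0 by blast+
  then show ?thesis by simp
qed

lemma dyadic_is_cube:
  assumes "R \<in> dyadic Q"
  shows "is_cube R"
proof -
  obtain a l k and m :: "'a \<Rightarrow> nat" where "0 < l"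
     "R = hcube (\<chi> i. a $ i + real (m i) * (l / 2 ^ k)) (l / 2 ^ k)"
    using assms unfolding dyadic_def by blast
  moreover from this have "0 < l / 2 ^ k" by simp
  ultimately show ?thesis unfolding is_cube_def by blast
qed

lemma is_cube_of_dyadic: "R \<in> dyadic Q \<Longrightarrow> is_cube Q"
  unfolding dyadic_def is_cube_def by blast

lemma is_cube_lmeasurable: "is_cube Q \<Longrightarrow> Q \<in> lmeasurable"
  using hcube_lmeasurable unfolding is_cube_def by blast

lemma is_cube_measure_pos: "is_cube Q \<Longrightarrow> 0 < measure lebesgue Q"
  unfolding is_cube_def by (auto simp: measure_hcube)

lemma dyadic_subset:
  assumes "R \<in> dyadic Q" shows "R \<subseteq> Q"
proof -
  obtain a l where Q: "0 < l" "Q = hcube a l" using assms is_cube_of_dyadic is_cube_def by blast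
  then obtain k x where x: "x \<in> hcube a l" "R = dcell a l k x" using assms dyadic_hcube by blast
  then show ?thesis using dcell_mono[of 0 k a l x] dcell_0[of l x a] Q by auto
qed

lemma dyadic_trans:
  fixes Q :: "(real^'n) set"
  assumes "R \<in> dyadic Q" "S \<in> dyadic R" shows "S \<in> dyadic Q"
proof -
  obtain a l where Q: "0 < l" "Q = hcube a l" using assms is_cube_of_dyadic is_cube_def by blast
  then obtain k x where x: "x \<in> hcube a l" "R = dcell a l k x" using assms dyadic_hcube by blast
  define h where "h = l / 2 ^ k"
  define m where "m i = \<lfloor>(x $ i - a $ i) * 2 ^ k / l\<rfloor>" for i
  define b where "b = (\<chi> i. a $ i + of_int (m i) * h)"
  have h: "0 < h" and R: "R = hcube b h"
    using x Q by (simp_all add: dcell_eq_hcube b_def h_def m_def)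
  obtain j y where y: "y \<in> R" and S: "S = dcell b h j y"
    using assms(2) dyadic_hcube[OF h, of b] R by auto
  \<comment> \<open>The rescaled coordinates relative to \<open>R\<close> and to \<open>Q\<close>
    differ by an integer, so their floors have the same level sets: generation \<open>j\<close> in
    \<open>R\<close> is generation \<open>k + j\<close> in \<open>Q\<close>.\<close>
  have "(y $ i - b $ i) * 2 ^ j / h = (y $ i - a $ i) * 2 ^ (k + j) / l - of_int (m i * 2 ^ j)" for y i
    using Q by (simp add: b_def h_def field_simps power_add)
  then have "dcell b h j y = dcell a l (k + j) y"
    unfolding dcell_def by (simp del: of_int_mult of_int_power)
  moreover have "y \<in> hcube a l" using y dyadic_subset[OF assms(1)] Q by auto
  ultimately show ?thesis using S Q dyadic_hcube by blast
qed

lemma countable_dyadic: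
  fixes Q :: "(real^'n) set"
  assumes "is_cube Q"
  shows "countable (dyadic Q)"
proof -
  obtain a l where Q: "0 < l" "Q = hcube a l" using assms is_cube_def by blast
  define c where "c = (\<lambda>(k :: nat, m :: 'n \<Rightarrow> nat). hcube (\<chi> i. a $ i + real (m i) * (l / 2 ^ k)) (l / 2 ^ k))"
  have "dyadic Q \<subseteq> range c"
  proof
    fix R assume "R \<in> dyadic Q"
    then obtain a' l' k and m :: "'n \<Rightarrow> nat" where h: "0 < l'" "Q = hcube a' l'"
       "R = hcube (\<chi> i. a' $ i + real (m i) * (l' / 2 ^ k)) (l' / 2 ^ k)"
      unfolding dyadic_def by blast
    then have "a' = a" "l' = l" using hcube_inject[of l l' a a'] Q by auto
    then have "R = c (k, m)" using h by (simp add: c_def)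
    then show "R \<in> range c" by blast
  qed
  then show ?thesis by (rule countable_subset) auto
qed

section \<open>Maximal dyadic cubes\<close>

lemma measure_dcell:
  assumes "0 < l"
  shows "measure lebesgue (dcell a l k (x::real^'n)) = (l / 2 ^ k) ^ CARD('n)"
  using assms by (simp add: dcell_eq_hcube measure_hcube)

text \<open>The family consists of the maximal cubes with the property \<open>P\<close>, and \<open>R'\<close> is the dyadic
  parent of \<open>R\<close>.\<close>

lemma dyadic_stopping:
  fixes Q :: "(real^'n) set"
  assumes "is_cube Q"
  obtains F where "F \<subseteq> {R \<in> dyadic Q. P R}" "disjoint F"
    "\<And>S. S \<in> dyadic Q \<Longrightarrow> P S \<Longrightarrow> \<exists>R\<in>F. S \<subseteq> R"
    "\<And>R. R \<in> F \<Longrightarrow> R \<noteq> Q \<Longrightarrow>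
       \<exists>R'\<in>dyadic Q. R \<subseteq> R' \<and> measure lebesgue R' = 2 ^ CARD('n) * measure lebesgue R \<and> \<not> P R'"
proof -
  obtain a l where l: "0 < l" and Q: "Q = hcube a l" using assms is_cube_def by blast
  define D where "D = dcell a l"
  define U where "U = {x \<in> Q. \<exists>k. P (D k x)}"
  \<comment> \<open>Cells shrink as the generation grows, so the least generation with
    \<open>P\<close> gives the largest cube around \<open>x\<close>.\<close>
  define \<kappa> where "\<kappa> x = (LEAST k. P (D k x))" for x
  define F where "F = (\<lambda>x. D (\<kappa> x) x) ` U"
  have dy: "dyadic Q = {D k x |k x. x \<in> Q}" using dyadic_hcube[OF l] Q D_def by simp
  have P: "P (D (\<kappa> x) x)" if "x \<in> U" for x
    using that unfolding U_def \<kappa>_def by (auto intro: LeastI)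
  have notP: "\<not> P (D j x)" if "j < \<kappa> x" for j x
    using that not_less_Least unfolding \<kappa>_def by blast
  have DD: "D j y = D j x" if "j \<le> k" "y \<in> D k x" for j k x y
    using that dcell_nested unfolding D_def by blast
  \<comment> \<open>All points of a selected cube select that same cube; hence two selected cubes
    with a common point coincide.\<close>
  have \<kappa>_const: "\<kappa> y = \<kappa> x" if "x \<in> U" "y \<in> D (\<kappa> x) x" for x y
  proof -
    have "P (D (\<kappa> x) y)" using P[OF that(1)] DD[OF order_refl that(2)] by simp
    moreover have "\<not> P (D j y)" if "j < \<kappa> x" for j
      using notP[OF that] DD[of j "\<kappa> x" y x] that \<open>y \<in> D (\<kappa> x) x\<close> by simp
    ultimately show ?thesis unfolding \<kappa>_def[of y] by (intro Least_equality) (auto simp: not_less[symmetric])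
  qed
  show ?thesis
  proof (rule that)
    show "F \<subseteq> {R \<in> dyadic Q. P R}" using P unfolding F_def dy U_def by blast
    show "disjoint F"
    proof (rule disjointI)
      fix R S assume "R \<in> F" "S \<in> F" and ne: "R \<noteq> S"
      then obtain x y where xy: "x \<in> U" "y \<in> U" "R = D (\<kappa> x) x" "S = D (\<kappa> y) y" unfolding F_def by blast
      show "R \<inter> S = {}"
      proof (rule ccontr)
        assume "R \<inter> S \<noteq> {}"
        then obtain z where "z \<in> R" "z \<in> S" by blast
        then have "\<kappa> z = \<kappa> x" "\<kappa> z = \<kappa> y" "D (\<kappa> x) z = R" "D (\<kappa> y) z = S"
          using \<kappa>_const[of x z] \<kappa>_const[of y z] DD[OF order_refl, of z "\<kappa> x" x]
            DD[OF order_refl, of z "\<kappa> y" y] xy by metis+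
        then show False using ne by metis
      qed
    qed
    fix S assume "S \<in> dyadic Q" "P S"
    then obtain k x where kx: "x \<in> Q" "S = D k x" unfolding dy by blast
    then have "P (D k x)" using \<open>P S\<close> by simp
    then have "x \<in> U" using kx(1) unfolding U_def by blast
    then have "D (\<kappa> x) x \<in> F" unfolding F_def by (rule imageI)
    moreover have "\<kappa> x \<le> k" unfolding \<kappa>_def by (rule Least_le[of "\<lambda>k. P (D k x)", OF \<open>P (D k x)\<close>])
    then have "S \<subseteq> D (\<kappa> x) x" using kx(2) dcell_mono[of "\<kappa> x" k] unfolding D_def by simp
    ultimately show "\<exists>R\<in>F. S \<subseteq> R" by (intro bexI)
  next
    fix R assume "R \<in> F" "R \<noteq> Q"
    then obtain x where x: "x \<in> U" "R = D (\<kappa> x) x" unfolding F_def by blast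
    then have "x \<in> Q" by (simp add: U_def)
    then have "D 0 x = Q" using dcell_0 l Q D_def by simp
    \<comment> \<open>Generation 0 is \<open>Q\<close> itself, so \<open>R \<noteq> Q\<close> leaves
      room for one generation less. That cell is the parent, and minimality of
      \<open>\<kappa> x\<close> denies it \<open>P\<close>.\<close>
    then obtain j where j: "\<kappa> x = Suc j" using \<open>R \<noteq> Q\<close> x by (cases "\<kappa> x") auto
    have "D j x \<in> dyadic Q" using dcell_in_dyadic l \<open>x \<in> Q\<close> Q D_def by simp
    moreover have "R \<subseteq> D j x" using x j dcell_mono[of j "Suc j"] D_def by simp
    moreover have "measure lebesgue (D j x) = 2 ^ CARD('n) * measure lebesgue R"
      using x j l by (simp add: D_def measure_dcell power_mult_distrib[symmetric])
    moreover have "\<not> P (D j x)" by (rule notP) (simp add: j)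
    ultimately show "\<exists>R'\<in>dyadic Q. R \<subseteq> R' \<and> measure lebesgue R' = 2 ^ CARD('n) * measure lebesgue R \<and> \<not> P R'"
      by (intro bexI conjI)
  qed
qed

section \<open>Coverings by dyadic cubes and superlevel sets\<close>

lemma small_dyadic_in_open:
  fixes Q U :: "(real^'n) set"
  assumes "is_cube Q" "open U" "x \<in> Q" "x \<in> U"
  obtains R where "R \<in> dyadic Q" "x \<in> R" "R \<subseteq> U"
proof -
  obtain a l where l: "0 < l" and Q: "Q = hcube a l" using assms is_cube_def by blast
  obtain e where e: "0 < e" "ball x e \<subseteq> U" using assms open_contains_ball by blast
  \<comment> \<open>The l1 norm bounds the distance of two points of a generation \<open>k\<close>
    cell by \<open>CARD('n) * l / 2 ^ k\<close>, which this choice makes smaller than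
    \<open>e\<close>.\<close>
  obtain k where k: "real CARD('n) * l / e < 2 ^ k" using real_arch_pow[of 2 "real CARD('n) * l / e"] by auto
  have "y \<in> U" if "y \<in> dcell a l k x" for y
  proof -
    define b where "b = (\<chi> i. a $ i + of_int \<lfloor>(x $ i - a $ i) * 2 ^ k / l\<rfloor> * (l / 2 ^ k))"
    have "x \<in> hcube b (l / 2 ^ k)" "y \<in> hcube b (l / 2 ^ k)"
      using that dcell_self[of x a l k] l unfolding dcell_eq_hcube[OF l] b_def by auto
    then have c: "\<bar>(x - y) $ i\<bar> \<le> l / 2 ^ k" for i by (auto simp: hcube_def abs_le_iff) (smt (verit))+
    have "dist x y \<le> (\<Sum>i\<in>UNIV. \<bar>(x - y) $ i\<bar>)" unfolding dist_norm by (rule norm_le_l1_cart)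
    also have "\<dots> \<le> real CARD('n) * (l / 2 ^ k)" using sum_bounded_above[of UNIV, OF c] by simp
    also have "\<dots> < e" using k e by (simp add: field_simps)
    finally show ?thesis using e by auto
  qed
  then have "dcell a l k x \<subseteq> U" by (rule subsetI)
  moreover have "dcell a l k x \<in> dyadic Q" using dcell_in_dyadic l assms(3) Q by simp
  ultimately show ?thesis by (intro that[of "dcell a l k x"] dcell_self)
qed

text \<open>Continuity from below along an enumeration. It carries estimates for finite subfamilies
  over to whole stopping families, both for Lebesgue measure and for a measure with density
  \<open>norm (g x)\<close>.\<close>

lemma emeasure_countable_Union_le:
  assumes "countable F" "\<And>A. A \<in> F \<Longrightarrow> A \<in> sets M"
    and bound: "\<And>T. finite T \<Longrightarrow> T \<subseteq> F \<Longrightarrow> emeasure M (\<Union>T) \<le> b"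
  shows "emeasure M (\<Union>F) \<le> b"
proof (cases "F = {}")
  case False
  define A where "A n = (\<Union>i\<le>n. from_nat_into F i)" for n
  have in_F: "from_nat_into F i \<in> F" for i using False by (rule from_nat_into)
  have "range A \<subseteq> sets M" using assms(2) in_F unfolding A_def by blast
  moreover have "incseq A" unfolding A_def by (intro incseq_SucI) force
  ultimately have "emeasure M (\<Union>n. A n) = (SUP n. emeasure M (A n))"
    by (rule SUP_emeasure_incseq[symmetric])
  also have "\<dots> \<le> b"
  proof (rule SUP_least)
    show "emeasure M (A n) \<le> b" for n
      using bound[of "from_nat_into F ` {..n}"] in_F unfolding A_def by blast
  qed
  also have "(\<Union>n. A n) = \<Union>(range (from_nat_into F))" unfolding A_def by blast
  also have "range (from_nat_into F) = F" using False assms(1) by simp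
  finally show ?thesis .
qed (use bound[of "{}"] in simp)

lemma dyadic_lmeasurable: "R \<in> dyadic Q \<Longrightarrow> R \<in> lmeasurable"
  using dyadic_is_cube is_cube_lmeasurable by blast

lemma dyadic_sets_lebesgue: "R \<in> dyadic Q \<Longrightarrow> R \<in> sets lebesgue"
  using dyadic_lmeasurable by (rule fmeasurableD)

lemma measure_dyadic_pos: "R \<in> dyadic Q \<Longrightarrow> 0 < measure lebesgue R"
  using dyadic_is_cube is_cube_measure_pos by blast

lemma avg_nonneg: "0 \<le> avg R f"
  unfolding avg_def by (intro mult_nonneg_nonneg integral_nonneg) auto

lemma avg_mult_measure:
  assumes "R \<in> dyadic Q"
  shows "avg R f * measure lebesgue R = (LINT x:R|lebesgue. norm (f x))"
  using dyadic_sets_lebesgue[OF assms] measure_dyadic_pos[OF assms]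
  by (simp add: avg_def integral_restrict_space set_lebesgue_integral_def)

lemma set_integrable_norm_lebesgue:
  fixes g :: "real^'n \<Rightarrow> 'b::{banach,second_countable_topology}"
  assumes "integrable lebesgue g" "A \<in> sets lebesgue"
  shows "set_integrable lebesgue A (\<lambda>x. norm (g x))"
  unfolding set_integrable_def using assms by (intro integrable_mult_indicator integrable_norm)

lemma set_lintegral_norm_mono:
  fixes g :: "real^'n \<Rightarrow> 'b::{banach,second_countable_topology}"
  assumes "set_integrable lebesgue B (\<lambda>x. norm (g x))" "A \<in> sets lebesgue" "A \<subseteq> B"
  shows "(LINT x:A|lebesgue. norm (g x)) \<le> (LINT x:B|lebesgue. norm (g x))"
  unfolding set_lebesgue_integral_def
  using assms set_integrable_subset[OF assms]
  by (intro integral_mono) (auto simp: set_integrable_def indicator_def)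

lemma set_integral_disjoint_Union:
  fixes g :: "real^'n \<Rightarrow> 'b::{banach,second_countable_topology}"
  assumes g: "integrable lebesgue g" and T: "finite T" "disjoint T" "T \<subseteq> dyadic Q"
  shows "(LINT x:\<Union>T|lebesgue. norm (g x)) = (\<Sum>R\<in>T. avg R g * measure lebesgue R)"
proof -
  have s: "R \<in> sets lebesgue" if "R \<in> T" for R using that T(3) dyadic_sets_lebesgue by blast
  have "(LINT x:(\<Union>R\<in>T. R)|lebesgue. norm (g x)) = (\<Sum>R\<in>T. LINT x:R|lebesgue. norm (g x))"
    using T(1,2) s set_integrable_norm_lebesgue[OF g]
    by (intro set_integral_finite_Union) (auto simp: disjoint_family_on_def disjoint_def)
  also have "\<dots> = (\<Sum>R\<in>T. avg R g * measure lebesgue R)"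
    using T(3) by (intro sum.cong refl avg_mult_measure[symmetric]) auto
  finally show ?thesis by simp
qed

lemma measure_disjoint_Union:
  assumes T: "finite T" "disjoint T" "T \<subseteq> dyadic Q"
  shows "measure lebesgue (\<Union>T) = (\<Sum>R\<in>T. measure lebesgue R)"
  using T(1,2) T(3)[THEN subsetD, THEN dyadic_lmeasurable]
  by (intro measure_Union') (auto simp: pairwise_def disjnt_def disjoint_def)

lemma Union_dyadic_lmeasurable:
  assumes T: "finite T" "T \<subseteq> dyadic Q"
  shows "\<Union>T \<in> lmeasurable"
  using T(1) T(2)[THEN subsetD, THEN dyadic_lmeasurable] by (intro fmeasurable.finite_Union) auto

text \<open>A substitute for the Lebesgue differentiation theorem: the exceptional set is compared
  with a cover by dyadic cubes inside an open set of almost the same measure.\<close>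

lemma measure_superlevel_le:
  fixes Q :: "(real^'n) set" and g :: "real^'n \<Rightarrow> 'b::{banach,second_countable_topology}"
  assumes cube: "is_cube Q" and g: "integrable lebesgue g" and "0 < s"
    and bound: "\<And>T. finite T \<Longrightarrow> disjoint T \<Longrightarrow> T \<subseteq> {R \<in> dyadic Q. s < avg R g} \<Longrightarrow>
       measure lebesgue (\<Union>T) \<le> b"
  shows "measure lebesgue {x \<in> Q. norm (g x) > 2 * s} \<le> b"
proof -
  \<comment> \<open>The set where the dyadic maximal function of \<open>g\<close> on
    \<open>Q\<close> exceeds \<open>s\<close>. It is the union of its maximal cubes, whose
    disjointness makes \<open>bound\<close> applicable.\<close>
  define E where "E = \<Union>{R \<in> dyadic Q. s < avg R g}"
  have E_sets: "E \<in> sets lebesgue"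
    unfolding E_def using countable_dyadic[OF cube] dyadic_sets_lebesgue
    by (intro sets.countable_Union) (auto intro: countable_subset)
  have "0 \<le> b" using bound[of "{}"] by simp
  have E_le: "emeasure lebesgue E \<le> ennreal b"
  proof -
    obtain F where F: "F \<subseteq> {R \<in> dyadic Q. s < avg R g}" "disjoint F"
      "\<And>S. S \<in> dyadic Q \<Longrightarrow> s < avg S g \<Longrightarrow> \<exists>R\<in>F. S \<subseteq> R"
      by (rule dyadic_stopping[OF cube, of "\<lambda>R. s < avg R g"]) blast
    have "E \<subseteq> \<Union>F" unfolding E_def using F(3) by blast
    moreover have "\<Union>F \<subseteq> E" unfolding E_def using F(1) by blast
    ultimately have "E = \<Union>F" by (rule equalityI)
    moreover have "emeasure lebesgue (\<Union>F) \<le> ennreal b"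
    proof (rule emeasure_countable_Union_le)
      show "countable F" using countable_dyadic[OF cube] F(1) by (auto intro: countable_subset)
      show "A \<in> sets lebesgue" if "A \<in> F" for A using that F(1) dyadic_sets_lebesgue by blast
      fix T assume T: "finite T" "T \<subseteq> F"
      have "disjoint T" using T(2) F(2) by (rule pairwise_subset[rotated])
      then have "measure lebesgue (\<Union>T) \<le> b" using bound T F(1) by auto
      moreover have "\<Union>T \<in> lmeasurable" using T F(1) by (intro Union_dyadic_lmeasurable[of T Q]) auto
      ultimately show "emeasure lebesgue (\<Union>T) \<le> ennreal b"
        by (simp add: emeasure_eq_measure2 ennreal_leI)
    qed
    ultimately show ?thesis by simp
  qed
  then have E_lm: "E \<in> lmeasurable" using E_sets by (intro fmeasurableI) (auto simp: le_less_trans)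
  have E_le': "measure lebesgue E \<le> b"
    using E_le \<open>0 \<le> b\<close> E_lm by (simp add: emeasure_eq_measure2)
  \<comment> \<open>Here \<open>norm (g x)\<close> exceeds \<open>2 * s\<close> although every
    dyadic cube around \<open>x\<close> has average at most \<open>s\<close>. The factor 2 is the
    room that the covering argument needs to show that this set is null.\<close>
  define H where "H = {x \<in> Q. norm (g x) > 2 * s} - E"
  have [measurable]: "g \<in> borel_measurable lebesgue" using g by simp
  have Q: "Q \<in> lmeasurable" "Q \<in> sets lebesgue" using cube is_cube_lmeasurable by auto
  have G_eq: "{x \<in> Q. norm (g x) > 2 * s} = Q \<inter> {x \<in> space lebesgue. norm (g x) > 2 * s}" by auto
  have G_sets: "{x \<in> Q. norm (g x) > 2 * s} \<in> sets lebesgue"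
    unfolding G_eq by (intro sets.Int Q(2)) measurable
  have H_lm: "H \<in> lmeasurable"
    by (rule fmeasurableI2[OF Q(1)]) (use G_sets E_sets in \<open>auto simp: H_def\<close>)
  have "measure lebesgue H = 0"
  proof (rule ccontr)
    assume "measure lebesgue H \<noteq> 0"
    then have Hpos: "0 < measure lebesgue H" by (simp add: zero_less_measure_iff)
    \<comment> \<open>This \<open>U\<close> has measure less than twice that of \<open>H\<close>.
      Covering \<open>H\<close> by disjoint dyadic cubes inside \<open>U\<close> with averages at
      most \<open>s\<close> gives 2 s |H| \<le> \<nu>(H) \<le> \<nu>(\<Union>F) \<le> s |U| < 2 s
      |H|, a contradiction.\<close>
    obtain U where U: "open U" "H \<subseteq> U" "U - H \<in> lmeasurable"
        "emeasure lebesgue (U - H) < ennreal (measure lebesgue H)"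
      using sets_lebesgue_outer_open[OF fmeasurableD[OF H_lm] Hpos] by metis
    have U_eq: "U = H \<union> (U - H)" using U(2) by blast
    have U_lm: "U \<in> lmeasurable" by (subst U_eq) (intro fmeasurable.Un H_lm U(3))
    have "measure lebesgue (U - H) < measure lebesgue H"
      using U(3,4) Hpos by (simp add: emeasure_eq_measure2 ennreal_less_iff)
    then have U_lt: "measure lebesgue U < 2 * measure lebesgue H"
      using measure_Un_le[of H lebesgue "U - H"] H_lm U(3) U_eq by (simp add: fmeasurableD)
    obtain F where F: "F \<subseteq> {R \<in> dyadic Q. R \<subseteq> U \<and> avg R g \<le> s}" "disjoint F"
      "\<And>S. S \<in> dyadic Q \<Longrightarrow> S \<subseteq> U \<and> avg S g \<le> s \<Longrightarrow> \<exists>R\<in>F. S \<subseteq> R"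
      by (rule dyadic_stopping[OF cube, of "\<lambda>R. R \<subseteq> U \<and> avg R g \<le> s"]) blast
    have HF: "H \<subseteq> \<Union>F"
    proof
      fix x assume x: "x \<in> H"
      then obtain R where R: "R \<in> dyadic Q" "x \<in> R" "R \<subseteq> U"
        using small_dyadic_in_open[OF cube U(1), of x] U(2) unfolding H_def by blast
      moreover have "avg R g \<le> s"
      proof (rule ccontr)
        assume "\<not> avg R g \<le> s"
        then have "x \<in> E" using R unfolding E_def by auto
        then show False using x by (simp add: H_def)
      qed
      ultimately show "x \<in> \<Union>F" using F(3)[of R] by blast
    qed
    define \<nu> where "\<nu> = density lebesgue (\<lambda>x. ennreal (norm (g x)))"
    have \<nu>_eq: "emeasure \<nu> A = ennreal (LINT x:A|lebesgue. norm (g x))" if "A \<in> sets lebesgue" for A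
    proof -
      have "emeasure \<nu> A = (\<integral>\<^sup>+ x. ennreal (norm (g x)) * indicator A x \<partial>lebesgue)"
        unfolding \<nu>_def using that by (intro emeasure_density) measurable
      also have "\<dots> = (\<integral>\<^sup>+ x. ennreal (indicator A x *\<^sub>R norm (g x)) \<partial>lebesgue)"
        by (intro nn_integral_cong) (auto simp: indicator_def)
      also have "\<dots> = ennreal (LINT x:A|lebesgue. norm (g x))"
        unfolding set_lebesgue_integral_def
        using set_integrable_norm_lebesgue[OF g that] unfolding set_integrable_def
        by (intro nn_integral_eq_integral) auto
      finally show ?thesis .
    qed
    have "emeasure \<nu> (\<Union>F) \<le> ennreal (s * measure lebesgue U)"
    proof (rule emeasure_countable_Union_le)
      show "countable F" using countable_dyadic[OF cube] F(1) by (auto intro: countable_subset)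
      show "A \<in> sets \<nu>" if "A \<in> F" for A using that F(1) dyadic_sets_lebesgue unfolding \<nu>_def by auto
      fix T assume T: "finite T" "T \<subseteq> F"
      have dT: "disjoint T" using T(2) F(2) by (rule pairwise_subset[rotated])
      have TQ: "T \<subseteq> dyadic Q" using T F(1) by blast
      have TU: "\<Union>T \<subseteq> U" using T F(1) by blast
      have lm: "\<Union>T \<in> lmeasurable" by (rule Union_dyadic_lmeasurable[OF T(1) TQ])
      have "(LINT x:\<Union>T|lebesgue. norm (g x)) = (\<Sum>R\<in>T. avg R g * measure lebesgue R)"
        by (rule set_integral_disjoint_Union[OF g T(1) dT TQ])
      also have "\<dots> \<le> (\<Sum>R\<in>T. s * measure lebesgue R)"
        using T F(1) by (intro sum_mono mult_right_mono) auto
      also have "\<dots> = s * measure lebesgue (\<Union>T)"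
        using measure_disjoint_Union[OF T(1) dT TQ] by (simp add: sum_distrib_left)
      also have "\<dots> \<le> s * measure lebesgue U"
        using \<open>0 < s\<close> TU lm U_lm by (intro mult_left_mono measure_mono_fmeasurable) (auto simp: fmeasurableD)
      finally show "emeasure \<nu> (\<Union>T) \<le> ennreal (s * measure lebesgue U)"
        using lm by (simp add: \<nu>_eq fmeasurableD ennreal_leI)
    qed
    moreover have "emeasure \<nu> H \<le> emeasure \<nu> (\<Union>F)"
    proof (rule emeasure_mono[OF HF])
      show "\<Union>F \<in> sets \<nu>"
        unfolding \<nu>_def using countable_dyadic[OF cube] F(1) dyadic_sets_lebesgue
        by (simp, intro sets.countable_Union) (auto intro: countable_subset)
    qed
    moreover have "ennreal (2 * s * measure lebesgue H) \<le> emeasure \<nu> H"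
    proof -
      have "2 * s * measure lebesgue H = (LINT x:H|lebesgue. 2 * s)"
        using H_lm by (simp add: set_lebesgue_integral_def)
      also have "\<dots> \<le> (LINT x:H|lebesgue. norm (g x))"
        unfolding set_lebesgue_integral_def
      proof (rule integral_mono)
        show "integrable lebesgue (\<lambda>x. indicator H x *\<^sub>R (2 * s))"
          using H_lm by (auto simp: fmeasurable_def intro!: integrable_scaleR_left)
        show "integrable lebesgue (\<lambda>x. indicator H x *\<^sub>R norm (g x))"
          using set_integrable_norm_lebesgue[OF g fmeasurableD[OF H_lm]] by (simp add: set_integrable_def)
        show "indicator H x *\<^sub>R (2 * s) \<le> indicator H x *\<^sub>R norm (g x)" for x
          by (auto simp: H_def indicator_def)
      qed
      finally show ?thesis using \<nu>_eq H_lm by (simp add: fmeasurableD ennreal_leI)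
    qed
    ultimately have "ennreal (2 * s * measure lebesgue H) \<le> ennreal (s * measure lebesgue U)"
      by (meson order_trans)
    then have "2 * s * measure lebesgue H \<le> s * measure lebesgue U"
      using \<open>0 < s\<close> by (simp add: ennreal_le_iff)
    moreover have "s * measure lebesgue U < s * (2 * measure lebesgue H)"
      using \<open>0 < s\<close> U_lt by (rule mult_strict_left_mono[rotated])
    ultimately show False by simp
  qed
  moreover have "measure lebesgue {x \<in> Q. norm (g x) > 2 * s} \<le> measure lebesgue (E \<union> H)"
    using G_sets fmeasurable.Un[OF E_lm H_lm] by (intro measure_mono_fmeasurable) (simp_all, auto simp: H_def)
  moreover have "measure lebesgue (E \<union> H) \<le> measure lebesgue E + measure lebesgue H"
    using E_lm H_lm by (intro measure_Un_le) (auto simp: fmeasurableD)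
  ultimately show ?thesis using E_le' by simp
qed

section \<open>The good-lambda inequality and its iteration\<close>

text \<open>The pointwise bound \<open>osc\<close> is integrated over V \<inter> R only, where V =
  \<Union>T. Its constant part then contributes a multiple of |V| rather than of |\<Union>T'|, and
  can be absorbed on the left once \<open>t\<close> is a large multiple of \<open>s\<close>. The
  part with \<open>h R\<close> is enlarged to all of R.\<close>

lemma stopping_step:
  fixes Q :: "(real^'n) set"
    and g :: "real^'n \<Rightarrow> 'b::{banach,second_countable_topology}"
    and h :: "(real^'n) set \<Rightarrow> real^'n \<Rightarrow> 'b"
  assumes cube: "is_cube Q" and g: "integrable lebesgue g"
    and h: "\<And>R. R \<in> dyadic Q \<Longrightarrow> set_integrable lebesgue R (h R)"
    and osc: "\<And>R. R \<in> dyadic Q \<Longrightarrow>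
       AE x in lebesgue. x \<in> R \<longrightarrow> norm (g x) \<le> c * avg R g + norm (h R x)"
    and c: "0 \<le> c" and avg_Q: "avg Q g \<le> s" and "s \<le> t"
    and T: "finite T" "disjoint T" "T \<subseteq> {R \<in> dyadic Q. t < avg R g}"
  obtains T' where "finite T'" "disjoint T'" "T' \<subseteq> {R \<in> dyadic Q. s < avg R g}"
    "t * measure lebesgue (\<Union>T) \<le> c * 2 ^ CARD('n) * s * measure lebesgue (\<Union>T)
       + (\<Sum>R\<in>T'. avg R (h R) * measure lebesgue R)"
proof -
  obtain F where F: "F \<subseteq> {R \<in> dyadic Q. s < avg R g}" "disjoint F"
    "\<And>S. S \<in> dyadic Q \<Longrightarrow> s < avg S g \<Longrightarrow> \<exists>R\<in>F. S \<subseteq> R"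
    "\<And>R. R \<in> F \<Longrightarrow> R \<noteq> Q \<Longrightarrow>
       \<exists>R'\<in>dyadic Q. R \<subseteq> R' \<and> measure lebesgue R' = 2 ^ CARD('n) * measure lebesgue R \<and> \<not> s < avg R' g"
    by (rule dyadic_stopping[OF cube, of "\<lambda>R. s < avg R g"]) (rule that; assumption)
  have "\<exists>R. R \<in> F \<and> S \<subseteq> R" if "S \<in> T" for S
  proof -
    have "S \<in> dyadic Q" "s < avg S g" using that T(3) \<open>s \<le> t\<close> by auto
    from F(3)[OF this] show ?thesis by blast
  qed
  \<comment> \<open>Only the maximal cubes chosen to contain a member of \<open>T\<close> are kept,
    which makes \<open>T'\<close> finite.\<close>
  then obtain r where r: "\<And>S. S \<in> T \<Longrightarrow> r S \<in> F \<and> S \<subseteq> r S" by metis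
  define T' where "T' = r ` T"
  define V where "V = \<Union>T"
  have TQ: "T \<subseteq> dyadic Q" using T(3) by blast
  have V_lm: "V \<in> lmeasurable" unfolding V_def by (rule Union_dyadic_lmeasurable[OF T(1) TQ])
  have T'F: "T' \<subseteq> F" using r by (auto simp: T'_def)
  have dT': "disjoint T'" using T'F F(2) by (rule pairwise_subset[rotated])
  have T'Q: "R \<in> dyadic Q" if "R \<in> T'" for R using that T'F F(1) by blast
  have avg_le: "avg R g \<le> 2 ^ CARD('n) * s" if "R \<in> T'" for R
  proof -
    \<comment> \<open>Here \<open>avg_Q\<close> enters: \<open>Q\<close> is not above level
      \<open>s\<close>, so \<open>R\<close> has a parent. The parent was not selected, and passing
      from its average to that of \<open>R\<close> costs the ratio of the volumes.\<close>
    have "R \<noteq> Q" using that T'F F(1) avg_Q by auto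
    then have "\<exists>R'\<in>dyadic Q. R \<subseteq> R' \<and> measure lebesgue R' = 2 ^ CARD('n) * measure lebesgue R \<and> \<not> s < avg R' g"
      using T'F that by (intro F(4)) auto
    then obtain R' where R': "R' \<in> dyadic Q" "R \<subseteq> R'"
        "measure lebesgue R' = 2 ^ CARD('n) * measure lebesgue R" "avg R' g \<le> s"
      unfolding not_less by (elim bexE conjE) (rule that; assumption)
    have "avg R g * measure lebesgue R \<le> avg R' g * measure lebesgue R'"
      unfolding avg_mult_measure[OF T'Q[OF that]] avg_mult_measure[OF R'(1)]
      by (intro set_lintegral_norm_mono set_integrable_norm_lebesgue[OF g]
          dyadic_sets_lebesgue[OF T'Q[OF that]] dyadic_sets_lebesgue[OF R'(1)] R'(2))
    also have "\<dots> \<le> s * measure lebesgue R'" using R'(4) by (intro mult_right_mono) auto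
    finally have "avg R g * measure lebesgue R \<le> 2 ^ CARD('n) * s * measure lebesgue R"
      by (simp add: R'(3) mult_ac)
    then show ?thesis using measure_dyadic_pos[OF T'Q[OF that]] by simp
  qed
  have local: "(LINT x:V \<inter> R|lebesgue. norm (g x))
      \<le> c * 2 ^ CARD('n) * s * measure lebesgue (V \<inter> R) + avg R (h R) * measure lebesgue R"
    if "R \<in> T'" for R
  proof -
    have R: "R \<in> dyadic Q" "R \<in> sets lebesgue" using T'Q[OF that] dyadic_sets_lebesgue by auto
    have VR: "V \<inter> R \<in> lmeasurable" "V \<inter> R \<in> sets lebesgue"
      using V_lm R by (auto intro: fmeasurable_Int_fmeasurable)
    have hR: "set_integrable lebesgue R (\<lambda>x. norm (h R x))"
      using h[OF R(1)] by (rule set_integrable_norm)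
    have hVR: "set_integrable lebesgue (V \<inter> R) (\<lambda>x. norm (h R x))"
      using hR VR(2) by (rule set_integrable_subset) blast
    have cVR: "set_integrable lebesgue (V \<inter> R) (\<lambda>x. c * (2 ^ CARD('n) * s))"
      using VR by (auto simp: set_integrable_def fmeasurable_def intro!: integrable_scaleR_left)
    have "(LINT x:V \<inter> R|lebesgue. norm (g x))
        \<le> (LINT x:V \<inter> R|lebesgue. c * (2 ^ CARD('n) * s) + norm (h R x))"
      unfolding set_lebesgue_integral_def
    proof (rule integral_mono_AE)
      show "integrable lebesgue (\<lambda>x. indicator (V \<inter> R) x *\<^sub>R norm (g x))"
        using set_integrable_norm_lebesgue[OF g VR(2)] by (simp add: set_integrable_def)
      show "integrable lebesgue (\<lambda>x. indicator (V \<inter> R) x *\<^sub>R (c * (2 ^ CARD('n) * s) + norm (h R x)))"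
        using set_integral_add(1)[OF cVR hVR] by (simp only: set_integrable_def)
      have le: "c * avg R g \<le> c * (2 ^ CARD('n) * s)"
        using avg_le[OF that] c by (rule mult_left_mono)
      show "AE x in lebesgue. indicator (V \<inter> R) x *\<^sub>R norm (g x)
          \<le> indicator (V \<inter> R) x *\<^sub>R (c * (2 ^ CARD('n) * s) + norm (h R x))"
        using osc[OF R(1)] by eventually_elim (use le in \<open>auto simp: indicator_def\<close>)
    qed
    also have "\<dots> = (LINT x:V \<inter> R|lebesgue. c * (2 ^ CARD('n) * s)) + (LINT x:V \<inter> R|lebesgue. norm (h R x))"
      by (rule set_integral_add(2)[OF cVR hVR])
    also have "(LINT x:V \<inter> R|lebesgue. c * (2 ^ CARD('n) * s)) = c * 2 ^ CARD('n) * s * measure lebesgue (V \<inter> R)"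
      using VR by (simp add: set_lebesgue_integral_def)
    also have "(LINT x:V \<inter> R|lebesgue. norm (h R x)) \<le> avg R (h R) * measure lebesgue R"
      unfolding avg_mult_measure[OF R(1)]
      by (rule set_lintegral_norm_mono[OF hR VR(2)]) blast
    finally show ?thesis by simp
  qed
  have V_eq: "V = (\<Union>R\<in>T'. V \<inter> R)" using r unfolding V_def T'_def by blast
  have fT': "finite T'" using T(1) by (simp add: T'_def)
  have "t * measure lebesgue V = (\<Sum>S\<in>T. t * measure lebesgue S)"
    unfolding V_def measure_disjoint_Union[OF T(1,2) TQ] by (rule sum_distrib_left)
  also have "\<dots> \<le> (\<Sum>S\<in>T. avg S g * measure lebesgue S)"
    using T(3) by (intro sum_mono mult_right_mono) auto
  also have "\<dots> = (LINT x:V|lebesgue. norm (g x))"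
    unfolding V_def by (rule set_integral_disjoint_Union[OF g T(1,2) TQ, symmetric])
  also have "\<dots> = (LINT x:(\<Union>R\<in>T'. V \<inter> R)|lebesgue. norm (g x))" using V_eq by simp
  also have "\<dots> = (\<Sum>R\<in>T'. LINT x:V \<inter> R|lebesgue. norm (g x))"
  proof (rule set_integral_finite_Union[OF fT'])
    show "disjoint_family_on (\<lambda>R. V \<inter> R) T'"
      using dT' by (auto simp: disjoint_family_on_def disjoint_def)
    show s: "V \<inter> R \<in> sets lebesgue" if "R \<in> T'" for R
      using V_lm dyadic_sets_lebesgue T'Q[OF that] by (intro sets.Int) (auto simp: fmeasurableD)
    show "set_integrable lebesgue (V \<inter> R) (\<lambda>x. norm (g x))" if "R \<in> T'" for R
      by (rule set_integrable_norm_lebesgue[OF g s[OF that]])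
  qed
  also have "\<dots> \<le> (\<Sum>R\<in>T'. c * 2 ^ CARD('n) * s * measure lebesgue (V \<inter> R) + avg R (h R) * measure lebesgue R)"
    by (rule sum_mono[OF local])
  also have "\<dots> = c * 2 ^ CARD('n) * s * (\<Sum>R\<in>T'. measure lebesgue (V \<inter> R)) + (\<Sum>R\<in>T'. avg R (h R) * measure lebesgue R)"
    by (simp only: sum.distrib sum_distrib_left)
  also have "(\<Sum>R\<in>T'. measure lebesgue (V \<inter> R)) = measure lebesgue (\<Union>R\<in>T'. V \<inter> R)"
  proof (rule measure_UNION'[symmetric, OF fT'])
    show "V \<inter> R \<in> lmeasurable" if "R \<in> T'" for R
      using V_lm dyadic_sets_lebesgue T'Q[OF that] by (auto intro: fmeasurable_Int_fmeasurable)
    show "pairwise (\<lambda>R S. disjnt (V \<inter> R) (V \<inter> S)) T'"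
      using dT' by (auto simp: pairwise_def disjnt_def disjoint_def)
  qed
  finally have "t * measure lebesgue V \<le> c * 2 ^ CARD('n) * s * measure lebesgue V
       + (\<Sum>R\<in>T'. avg R (h R) * measure lebesgue R)" using V_eq by simp
  then show ?thesis using that[OF fT' dT'] T'F F(1) unfolding V_def by blast
qed

text \<open>Distinguishing \<open>a \<le> s\<close> from \<open>a > s\<close> replaces Hoelder's inequality in the sums below.\<close>

lemma le_threshold_powr:
  fixes a s p :: real
  assumes "1 < p" "0 < s" "0 \<le> a"
  shows "a \<le> s + s powr (1 - p) * a powr p"
proof (cases "a \<le> s")
  case False
  then have "a = a powr (1 - p) * a powr p" using assms by (simp flip: powr_add)
  also have "\<dots> \<le> s powr (1 - p) * a powr p"
    using False assms by (intro mult_right_mono powr_mono2') auto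
  finally show ?thesis using assms by simp
next
  case True
  have "0 \<le> s powr (1 - p) * a powr p" by simp
  then show ?thesis using True by linarith
qed

lemma two_le_mult_power:
  fixes c :: real
  assumes "1 \<le> c"
  shows "2 \<le> c * 2 ^ (n + 1)"
proof -
  have "1 * 1 \<le> c * 2 ^ n" using assms by (intro mult_mono) auto
  then show ?thesis by (simp add: mult.left_commute)
qed

text \<open>The truncation level \<open>good_lambda_eps p N\<close> is chosen so that the term carrying \<open>Y\<close> in
  \<open>good_lambda_absorb\<close> gets the coefficient \<open>1 / 2\<close>.\<close>

definition good_lambda_eps :: "real \<Rightarrow> real \<Rightarrow> real" where
  "good_lambda_eps p N = 1 / (4 * N powr (p - 1))"

text \<open>The factor left on \<open>k\<close> when the hypothesis of
  \<open>good_lambda_absorb\<close> is multiplied by \<open>2 * (N * s) powr (p - 1)\<close>. The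
  powers of \<open>s\<close> cancel, so it is the same at every level.\<close>

definition good_lambda_const :: "real \<Rightarrow> real \<Rightarrow> real" where
  "good_lambda_const p N = 2 * (N / good_lambda_eps p N) powr (p - 1)"

lemma good_lambda_eps_pos: "0 < N \<Longrightarrow> 0 < good_lambda_eps p N"
  by (simp add: good_lambda_eps_def)

lemma good_lambda_const_ge_1:
  assumes "1 < p" "1 \<le> N"
  shows "1 \<le> good_lambda_const p N"
proof -
  have "1 \<le> N powr (p - 1)" using assms by (intro ge_one_powr_ge_zero) auto
  then have "1 \<le> N * N powr (p - 1)" using assms(2) by (metis mult_mono mult_1 zero_le_one order_trans)
  then have "1 \<le> N / good_lambda_eps p N" by (simp add: good_lambda_eps_def)
  then have "1 \<le> (N / good_lambda_eps p N) powr (p - 1)" using assms(1) by (intro ge_one_powr_ge_zero) auto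
  then show ?thesis unfolding good_lambda_const_def by linarith
qed

text \<open>One multiplication brings the inequality to the weak-type scale. \<open>X\<close> and
  \<open>Y\<close> stand for the measures of the unions at levels \<open>N * s\<close> and
  \<open>s\<close>, and \<open>k\<close> for the JN bound
  \<open>K powr p * measure lebesgue Q\<close>.\<close>

lemma good_lambda_absorb:
  fixes s X Y k N p :: real
  assumes "0 < s" "0 < N"
    and le: "N * s / 2 * X \<le> good_lambda_eps p N * s * Y + (good_lambda_eps p N * s) powr (1 - p) * k"
  shows "(N * s) powr p * X \<le> s powr p * Y / 2 + good_lambda_const p N * k"
proof -
  define e where "e = good_lambda_eps p N"
  have e: "0 < e" unfolding e_def using assms(2) by (rule good_lambda_eps_pos)
  define w where "w = 2 * (N * s) powr (p - 1)"
  have w: "0 < w" using assms by (simp add: w_def)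
  have pow: "u powr p = u powr (p - 1) * u" if "0 < u" for u :: real
    using that powr_add[of u "p - 1" 1] by simp
  have 1: "w * (N * s / 2 * X) = (N * s) powr p * X"
    using assms by (simp add: w_def pow)
  have 2: "w * (e * s * Y) = s powr p * Y / 2"
    using assms by (simp add: w_def pow e_def good_lambda_eps_def powr_mult)
  have 3: "w * ((e * s) powr (1 - p) * k) = good_lambda_const p N * k"
  proof -
    have "(e * s) powr (1 - p) = 1 / (e * s) powr (p - 1)"
      using powr_minus_divide[of "e * s" "p - 1"] by simp
    then show ?thesis
      using assms e by (simp add: w_def good_lambda_const_def powr_mult powr_divide flip: e_def)
  qed
  show ?thesis
    using mult_left_mono[OF le less_imp_le[OF w]] unfolding e_def[symmetric] distrib_left 1 2 3 .
qed

text \<open>With D the good-lambda constant and b = K^p |Q|, the step bounds the quantity at one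
  level by half of that at the previous level plus D b. The bound 2 D b reproduces itself, since
  half of it plus D b is again 2 D b. The family is arbitrary in the induction because each step
  passes to another one.\<close>

lemma good_lambda_iterate:
  fixes Q :: "(real^'n) set"
    and g :: "real^'n \<Rightarrow> 'b::{banach,second_countable_topology}"
    and h :: "(real^'n) set \<Rightarrow> real^'n \<Rightarrow> 'b"
  assumes "1 < p" "0 < K"
    and cube: "is_cube Q" and g: "integrable lebesgue g"
    and h: "\<And>R. R \<in> dyadic Q \<Longrightarrow> set_integrable lebesgue R (h R)"
    and osc: "\<And>R. R \<in> dyadic Q \<Longrightarrow>
       AE x in lebesgue. x \<in> R \<longrightarrow> norm (g x) \<le> c * avg R g + norm (h R x)"
    and c: "1 \<le> c" and N: "N = c * 2 ^ (CARD('n) + 1)"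
    and avg_Q: "avg Q g \<le> K"
    and sum_le: "\<And>T. finite T \<Longrightarrow> disjoint T \<Longrightarrow> T \<subseteq> dyadic Q \<Longrightarrow>
       (\<Sum>R\<in>T. avg R (h R) powr p * measure lebesgue R) \<le> K powr p * measure lebesgue Q"
    and T: "finite T" "disjoint T" "T \<subseteq> {R \<in> dyadic Q. N ^ k * K < avg R g}"
  shows "(N ^ k * K) powr p * measure lebesgue (\<Union>T)
    \<le> 2 * good_lambda_const p N * (K powr p * measure lebesgue Q)"
  using T
proof (induction k arbitrary: T)
  case 0
  have N1: "1 \<le> N" using two_le_mult_power[OF c, of "CARD('n)"] unfolding N by linarith
  have Q: "Q \<in> lmeasurable" using cube by (rule is_cube_lmeasurable)
  have TQ: "T \<subseteq> dyadic Q" using 0(3) by blast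
  have "measure lebesgue (\<Union>T) \<le> measure lebesgue Q"
    using Union_dyadic_lmeasurable[OF 0(1) TQ] Q TQ dyadic_subset
    by (intro measure_mono_fmeasurable) (auto simp: fmeasurableD)
  then have "K powr p * measure lebesgue (\<Union>T) \<le> 1 * (K powr p * measure lebesgue Q)"
    by (simp add: mult_left_mono)
  also have "\<dots> \<le> 2 * good_lambda_const p N * (K powr p * measure lebesgue Q)"
    using good_lambda_const_ge_1[OF \<open>1 < p\<close> N1] by (intro mult_right_mono) auto
  finally show ?case by simp
next
  case (Suc k)
  define s where "s = N ^ k * K"
  define e where "e = good_lambda_eps p N * s"
  have N1: "1 \<le> N" using two_le_mult_power[OF c, of "CARD('n)"] unfolding N by linarith
  have s: "0 < s" using N1 \<open>0 < K\<close> by (simp add: s_def)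
  have e: "0 < e" using s N1 by (simp add: e_def good_lambda_eps_pos)
  have "K \<le> s" using N1 \<open>0 < K\<close> by (simp add: s_def)
  then have "avg Q g \<le> s" using avg_Q by linarith
  moreover have "s \<le> N * s" using N1 s by simp
  moreover have "T \<subseteq> {R \<in> dyadic Q. N * s < avg R g}" using Suc.prems(3) by (simp add: s_def mult_ac)
  moreover have "0 \<le> c" using c by simp
  ultimately obtain T' where T': "finite T'" "disjoint T'" "T' \<subseteq> {R \<in> dyadic Q. s < avg R g}"
    and step: "N * s * measure lebesgue (\<Union>T) \<le> c * 2 ^ CARD('n) * s * measure lebesgue (\<Union>T)
       + (\<Sum>R\<in>T'. avg R (h R) * measure lebesgue R)"
    using stopping_step[OF cube g h osc _ _ _ Suc.prems(1,2)] by blast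
  have T'Q: "T' \<subseteq> dyadic Q" using T'(3) by blast
  have "(\<Sum>R\<in>T'. avg R (h R) * measure lebesgue R)
      \<le> (\<Sum>R\<in>T'. (e + e powr (1 - p) * avg R (h R) powr p) * measure lebesgue R)"
    using le_threshold_powr[OF \<open>1 < p\<close> e avg_nonneg] by (intro sum_mono mult_right_mono) auto
  also have "\<dots> = e * measure lebesgue (\<Union>T') + e powr (1 - p) * (\<Sum>R\<in>T'. avg R (h R) powr p * measure lebesgue R)"
    unfolding measure_disjoint_Union[OF T'(1,2) T'Q]
    by (simp only: distrib_right sum.distrib sum_distrib_left mult.assoc)
  also have "\<dots> \<le> e * measure lebesgue (\<Union>T') + e powr (1 - p) * (K powr p * measure lebesgue Q)"
    using sum_le[OF T'(1,2) T'Q] by (intro add_left_mono mult_left_mono) auto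
  \<comment> \<open>Since \<open>c * 2 ^ CARD('n)\<close> is \<open>N / 2\<close>, the first term on
    the right of \<open>step\<close> takes away exactly half of the left side.\<close>
  finally have "N * s / 2 * measure lebesgue (\<Union>T)
      \<le> e * measure lebesgue (\<Union>T') + e powr (1 - p) * (K powr p * measure lebesgue Q)"
    using step unfolding N by (simp add: field_simps)
  then have "(N * s) powr p * measure lebesgue (\<Union>T)
      \<le> s powr p * measure lebesgue (\<Union>T') / 2 + good_lambda_const p N * (K powr p * measure lebesgue Q)"
    using s N1 by (intro good_lambda_absorb) (auto simp: e_def)
  moreover have "s powr p * measure lebesgue (\<Union>T') \<le> 2 * good_lambda_const p N * (K powr p * measure lebesgue Q)"
    using Suc.IH[OF T'(1,2)] T'(3) by (simp add: s_def)
  ultimately show ?case by (simp add: s_def mult_ac)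
qed

text \<open>Cube families are controlled only at the levels \<open>N ^ k * K\<close>. A given
  \<open>t\<close> is rounded down to twice such a level, the 2 coming from
  \<open>measure_superlevel_le\<close>; the rounding loses at most the factor
  \<open>(2 * N) powr p\<close>. For \<open>t \<le> 2 * K\<close> the measure of \<open>Q\<close>
  suffices.\<close>

lemma weak_type_of_oscillation:
  fixes Q :: "(real^'n) set"
    and g :: "real^'n \<Rightarrow> 'b::{banach,second_countable_topology}"
    and h :: "(real^'n) set \<Rightarrow> real^'n \<Rightarrow> 'b"
  assumes "1 < p" "0 < K"
    and cube: "is_cube Q" and g: "integrable lebesgue g"
    and h: "\<And>R. R \<in> dyadic Q \<Longrightarrow> set_integrable lebesgue R (h R)"
    and osc: "\<And>R. R \<in> dyadic Q \<Longrightarrow>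
       AE x in lebesgue. x \<in> R \<longrightarrow> norm (g x) \<le> c * avg R g + norm (h R x)"
    and c: "1 \<le> c" and N: "N = c * 2 ^ (CARD('n) + 1)"
    and avg_Q: "avg Q g \<le> K"
    and sum_le: "\<And>T. finite T \<Longrightarrow> disjoint T \<Longrightarrow> T \<subseteq> dyadic Q \<Longrightarrow>
       (\<Sum>R\<in>T. avg R (h R) powr p * measure lebesgue R) \<le> K powr p * measure lebesgue Q"
    and "0 < t"
  shows "t powr p * measure lebesgue {x \<in> Q. norm (g x) > t}
    \<le> (2 * N) powr p * (2 * good_lambda_const p N) * (K powr p * measure lebesgue Q)"
proof -
  have N2: "2 \<le> N" using two_le_mult_power[OF c] unfolding N .
  have M1: "1 \<le> 2 * good_lambda_const p N" using good_lambda_const_ge_1[of p N] \<open>1 < p\<close> N2 by simp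
  have Q: "Q \<in> lmeasurable" "Q \<in> sets lebesgue" using cube is_cube_lmeasurable by auto
  have [measurable]: "g \<in> borel_measurable lebesgue" using g by simp
  have G_lm: "{x \<in> Q. norm (g x) > u} \<in> lmeasurable" for u
  proof (rule fmeasurableI2[OF Q(1)])
    have "{x \<in> Q. norm (g x) > u} = Q \<inter> {x \<in> space lebesgue. norm (g x) > u}" by auto
    also have "\<dots> \<in> sets lebesgue" by (intro sets.Int Q(2)) measurable
    finally show "{x \<in> Q. norm (g x) > u} \<in> sets lebesgue" .
  qed auto
  show ?thesis
  proof (cases "t \<le> 2 * K")
    case True
    have "measure lebesgue {x \<in> Q. norm (g x) > t} \<le> measure lebesgue Q"
      using Q G_lm by (intro measure_mono_fmeasurable) (auto simp: fmeasurableD)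
    moreover have "t powr p \<le> (2 * K) powr p" using True \<open>0 < t\<close> \<open>1 < p\<close> by (intro powr_mono2) auto
    ultimately have "t powr p * measure lebesgue {x \<in> Q. norm (g x) > t} \<le> (2 * K) powr p * measure lebesgue Q"
      by (intro mult_mono) auto
    also have "\<dots> = 2 powr p * 1 * (K powr p * measure lebesgue Q)" using \<open>0 < K\<close> by (simp add: powr_mult)
    also have "\<dots> \<le> (2 * N) powr p * (2 * good_lambda_const p N) * (K powr p * measure lebesgue Q)"
      using M1 N2 \<open>1 < p\<close> by (intro mult_right_mono mult_mono powr_mono2) auto
    finally show ?thesis .
  next
    case False
    \<comment> \<open>The powers of \<open>N\<close> eventually exceed \<open>t / (2 * K)\<close>
      but \<open>N ^ 0\<close> does not, so \<open>k\<close> is the last exponent before the first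
      crossing.\<close>
    obtain n where "t / (2 * K) < N ^ n" using real_arch_pow[of N "t / (2 * K)"] N2 by auto
    moreover have "\<not> t / (2 * K) < N ^ 0" using False \<open>0 < K\<close> by simp
    ultimately obtain k where k: "\<not> t / (2 * K) < N ^ k" "t / (2 * K) < N ^ Suc k"
      using ex_least_nat_less[of "\<lambda>n. t / (2 * K) < N ^ n" n] by blast
    define s where "s = N ^ k * K"
    have s: "0 < s" using N2 \<open>0 < K\<close> by (simp add: s_def)
    have s1: "2 * s \<le> t" and s2: "t \<le> 2 * N * s"
      using k \<open>0 < K\<close> by (simp_all add: s_def field_simps)
    have "measure lebesgue {x \<in> Q. norm (g x) > t} \<le> measure lebesgue {x \<in> Q. norm (g x) > 2 * s}"
      using G_lm s1 by (intro measure_mono_fmeasurable) (auto simp: fmeasurableD)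
    also have "\<dots> \<le> 2 * good_lambda_const p N * (K powr p * measure lebesgue Q) / s powr p"
    proof (rule measure_superlevel_le[OF cube g s])
      fix T assume T: "finite T" "disjoint T" "T \<subseteq> {R \<in> dyadic Q. s < avg R g}"
      have "s powr p * measure lebesgue (\<Union>T) \<le> 2 * good_lambda_const p N * (K powr p * measure lebesgue Q)"
        unfolding s_def
        by (rule good_lambda_iterate[OF \<open>1 < p\<close> \<open>0 < K\<close> cube g h osc c N avg_Q sum_le T[unfolded s_def]])
      then show "measure lebesgue (\<Union>T) \<le> 2 * good_lambda_const p N * (K powr p * measure lebesgue Q) / s powr p"
        using s by (simp add: pos_le_divide_eq mult.commute)
    qed
    finally have m: "measure lebesgue {x \<in> Q. norm (g x) > t}
      \<le> 2 * good_lambda_const p N * (K powr p * measure lebesgue Q) / s powr p" .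
    have "t powr p \<le> (2 * N * s) powr p" using s2 \<open>0 < t\<close> \<open>1 < p\<close> by (intro powr_mono2) auto
    then have "t powr p * measure lebesgue {x \<in> Q. norm (g x) > t}
       \<le> (2 * N * s) powr p * (2 * good_lambda_const p N * (K powr p * measure lebesgue Q) / s powr p)"
      using m by (intro mult_mono) auto
    also have "(2 * N * s) powr p = (2 * N) powr p * s powr p" using s N2 by (simp add: powr_mult)
    finally show ?thesis using s by simp
  qed
qed

section \<open>Consequences of the local oscillation axioms\<close>

lemma L1_iff_integrable_cutoff:
  "Q \<in> sets lebesgue \<Longrightarrow> f \<in> L1 Q \<longleftrightarrow> integrable lebesgue (cutoff Q f)"
  by (simp add: L1_def cutoff_def integrable_restrict_space)

lemma integrable_cutoff_L1:
  assumes "f \<in> L1 Q" "R \<in> sets lebesgue" "Q \<in> sets lebesgue" "R \<subseteq> Q"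
  shows "integrable lebesgue (cutoff R f)"
proof -
  have "set_integrable lebesgue Q f"
    using assms(1,3) by (simp add: L1_iff_integrable_cutoff set_integrable_def cutoff_def)
  then have "set_integrable lebesgue R f" using assms(2,4) by (rule set_integrable_subset)
  then show ?thesis by (simp add: set_integrable_def cutoff_def)
qed

lemma integrable_imp_L1:
  assumes "integrable lebesgue f" "Q \<in> sets lebesgue"
  shows "f \<in> L1 Q"
  using integrable_mult_indicator[OF assms(2,1)] assms(2)
  by (simp add: L1_iff_integrable_cutoff cutoff_def)

context
  fixes Q0 :: "(real^'n) set"
    and B :: "(real^'n) set \<Rightarrow> (real^'n \<Rightarrow> 'b::{real_normed_field,banach,second_countable_topology}) \<Rightarrow> (real^'n \<Rightarrow> 'b)"
    and CB :: real
  assumes loc: "local_oscillation Q0 B CB"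
begin

lemma linear_A_of: "R \<in> dyadic Q0 \<Longrightarrow> linear_L1_operator Q0 (A_of B R)"
  using loc unfolding local_oscillation_def by (elim conjE) (rule bspec)

lemma A_of_bound:
  assumes "R \<in> dyadic Q0" "f \<in> L1 Q0"
  shows "AE x in lebesgue. x \<in> R \<longrightarrow> norm (A_of B R f x) \<le> CB * avg R f"
proof -
  have le: "Linf_norm R (A_of B R f) \<le> ereal (CB * avg R f)"
    using loc assms unfolding local_oscillation_def by blast
  have "AE x in lebesgue_on R. ereal (norm (A_of B R f x)) \<le> ereal (CB * avg R f)"
    using esssup_AE
    by (rule eventually_mono) (rule order_trans[OF _ le[unfolded Linf_norm_def]])
  then show ?thesis using dyadic_sets_lebesgue[OF assms(1)] by (simp add: AE_restrict_space_iff)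
qed

lemma integrable_cutoff_A_of:
  assumes R: "R \<in> dyadic Q0" and f: "f \<in> L1 Q0"
  shows "integrable lebesgue (cutoff R (A_of B R f))"
proof -
  have RQ: "R \<subseteq> Q0" by (rule dyadic_subset[OF R])
  have Q0: "Q0 \<in> sets lebesgue" using is_cube_lmeasurable[OF is_cube_of_dyadic[OF R]] by (rule fmeasurableD)
  have "A_of B R f \<in> borel_measurable (lebesgue_on Q0)"
    by (rule linear_A_of[OF R, unfolded linear_L1_operator_def, THEN conjunct1, rule_format, OF f])
  \<comment> \<open>\<open>A_of B R f\<close> is known to be measurable on \<open>Q0\<close> only.
    The extra indicator gives measurability on the whole space and disappears again because
    \<open>R \<subseteq> Q0\<close>.\<close>
  then have "(\<lambda>x. indicator Q0 x *\<^sub>R A_of B R f x) \<in> borel_measurable lebesgue"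
    using Q0 by (simp add: borel_measurable_restrict_space_iff)
  then have "integrable lebesgue (\<lambda>x. indicator R x *\<^sub>R (indicator Q0 x *\<^sub>R A_of B R f x))"
  proof (rule integrableI_bounded_set_indicator[OF dyadic_sets_lebesgue[OF R]])
    show "emeasure lebesgue R < \<infinity>"
      using dyadic_lmeasurable[OF R] unfolding fmeasurable_def by blast
    show "AE x in lebesgue. x \<in> R \<longrightarrow> norm (indicator Q0 x *\<^sub>R A_of B R f x) \<le> CB * avg R f"
      using A_of_bound[OF R f] by eventually_elim (use RQ in \<open>auto simp: indicator_def\<close>)
  qed
  also have "(\<lambda>x. indicator R x *\<^sub>R (indicator Q0 x *\<^sub>R A_of B R f x)) = cutoff R (A_of B R f)"
    using RQ by (intro ext) (auto simp: cutoff_def indicator_def)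
  finally show ?thesis .
qed

lemma integrable_cutoff_B:
  assumes R: "R \<in> dyadic Q0" and f: "f \<in> L1 Q0"
  shows "integrable lebesgue (cutoff R (B R f))"
proof -
  have Q0: "Q0 \<in> sets lebesgue" using is_cube_lmeasurable[OF is_cube_of_dyadic[OF R]] by (rule fmeasurableD)
  have "integrable lebesgue (\<lambda>x. cutoff R f x - cutoff R (A_of B R f) x)"
    using integrable_cutoff_L1[OF f dyadic_sets_lebesgue[OF R] Q0 dyadic_subset[OF R]]
      integrable_cutoff_A_of[OF R f] by (rule Bochner_Integration.integrable_diff)
  also have "(\<lambda>x. cutoff R f x - cutoff R (A_of B R f) x) = cutoff R (B R f)"
    by (intro ext) (auto simp: cutoff_def indicator_def A_of_def)
  finally show ?thesis .
qed

text \<open>Subtracting the part \<open>A_of B Q f\<close>, which \<open>B R\<close> annihilates on \<open>R \<subseteq> Q\<close>, leaves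
  \<open>B R f = g - A_of B R g\<close> on \<open>R\<close> for \<open>g = B Q f\<close>.\<close>

lemma oscillation_on_subcube:
  fixes f :: "real^'n \<Rightarrow> 'b"
  assumes Q: "Q \<in> dyadic Q0" and f: "f \<in> L1 Q0" and R: "R \<in> dyadic Q"
    and off: "\<And>x. x \<notin> Q \<Longrightarrow> f x = 0"
  defines "g \<equiv> cutoff Q (B Q f)"
  shows "AE x in lebesgue. x \<in> R \<longrightarrow> norm (g x) \<le> CB * avg R g + norm (B R f x)"
proof -
  define u where "u = cutoff Q (A_of B Q f)"
  have RQ0: "R \<in> dyadic Q0" by (rule dyadic_trans[OF Q R])
  have sub: "R \<subseteq> Q" "R \<subseteq> Q0" using dyadic_subset[OF R] dyadic_subset[OF RQ0] by auto
  have Q0: "Q0 \<in> sets lebesgue" using is_cube_lmeasurable[OF is_cube_of_dyadic[OF Q]] by (rule fmeasurableD)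
  have gL: "g \<in> L1 Q0" unfolding g_def by (rule integrable_imp_L1[OF integrable_cutoff_B[OF Q f] Q0])
  have uL: "u \<in> L1 Q0" unfolding u_def by (rule integrable_imp_L1[OF integrable_cutoff_A_of[OF Q f] Q0])
  \<comment> \<open>Because \<open>f\<close> vanishes off \<open>Q\<close>, this holds at every
    point although both summands are cut off. Additivity of \<open>A_of B R\<close> on
    \<open>L1 Q0\<close> therefore applies to \<open>f\<close> itself.\<close>
  have f_eq: "f = (\<lambda>y. g y + u y)"
    using off by (intro ext) (auto simp: g_def u_def cutoff_def indicator_def A_of_def)
  have "AE x in lebesgue_on Q0. A_of B R (\<lambda>y. g y + u y) x = A_of B R g x + A_of B R u x"
    by (rule linear_A_of[OF RQ0, unfolded linear_L1_operator_def, THEN conjunct2, THEN conjunct2,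
          THEN conjunct1, rule_format, OF gL uL])
  then have add: "AE x in lebesgue. x \<in> Q0 \<longrightarrow> A_of B R f x = A_of B R g x + A_of B R u x"
    using Q0 by (simp add: AE_restrict_space_iff f_eq[symmetric])
  have "AE x in lebesgue_on R. B R u x = 0"
    using loc RQ0 Q sub(1) f unfolding local_oscillation_def u_def by blast
  then have zero: "AE x in lebesgue. x \<in> R \<longrightarrow> B R u x = 0"
    using dyadic_sets_lebesgue[OF R] by (simp add: AE_restrict_space_iff)
  from add zero A_of_bound[OF RQ0 gL] show ?thesis
  proof eventually_elim
    case (elim x)
    show ?case
    proof
      assume x: "x \<in> R"
      have "f x - B R f x = A_of B R g x + (u x - B R u x)"
        using elim(1) x sub(2) by (auto simp: A_of_def[of B R f] A_of_def[of B R u])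
      moreover have "f x = g x + u x" using f_eq by metis
      ultimately have "g x = A_of B R g x + B R f x" using elim(2) x by (simp add: algebra_simps)
      then have "norm (g x) \<le> norm (A_of B R g x) + norm (B R f x)" by (metis norm_triangle_ineq)
      then show "norm (g x) \<le> CB * avg R g + norm (B R f x)" using elim(3) x by linarith
    qed
  qed
qed

end

section \<open>The two norms and the choice of the constant\<close>

lemma JN_norm_finite_sum_le:
  assumes "1 < p" "0 \<le> K" "is_cube Q" and J: "JN_norm B p Q f \<le> ennreal K"
    and T: "finite T" "disjoint T" "T \<subseteq> dyadic Q"
  shows "(\<Sum>R\<in>T. avg R (B R f) powr p * measure lebesgue R) \<le> K powr p * measure lebesgue Q"
proof -
  define S where "S = (\<Sum>R\<in>T. avg R (B R f) powr p * measure lebesgue R)"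
  have S: "0 \<le> S" unfolding S_def by (intro sum_nonneg) auto
  have Q: "0 < measure lebesgue Q" by (rule is_cube_measure_pos[OF assms(3)])
  have "enn_root p (ennreal (1 / measure lebesgue Q) *
       (\<Sum>\<^sub>\<infinity>R\<in>T. ennreal (avg R (B R f) powr p * measure lebesgue R))) \<le> JN_norm B p Q f"
    unfolding JN_norm_def using T by (intro SUP_upper) auto
  also have "(\<Sum>\<^sub>\<infinity>R\<in>T. ennreal (avg R (B R f) powr p * measure lebesgue R)) = ennreal S"
    using T(1) by (simp add: S_def sum_ennreal)
  also have "ennreal (1 / measure lebesgue Q) * ennreal S = ennreal (S / measure lebesgue Q)"
    using S Q by (simp flip: ennreal_mult)
  also have "enn_root p \<dots> = ennreal ((S / measure lebesgue Q) powr (1 / p))"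
    using S Q by (simp add: enn_root_def)
  finally have "ennreal ((S / measure lebesgue Q) powr (1 / p)) \<le> ennreal K" using J by (rule order_trans)
  then have "(S / measure lebesgue Q) powr (1 / p) \<le> K" using \<open>0 \<le> K\<close> by (simp add: ennreal_le_iff)
  then have "((S / measure lebesgue Q) powr (1 / p)) powr p \<le> K powr p"
    using \<open>1 < p\<close> by (intro powr_mono2) auto
  then have "S / measure lebesgue Q \<le> K powr p" using S Q \<open>1 < p\<close> by (simp add: powr_powr)
  then show ?thesis using Q by (simp add: S_def pos_divide_le_eq)
qed

lemma weak_Lp_norm_leI:
  assumes "1 < p" "is_cube Q" "0 \<le> M"
    and le: "\<And>t. 0 < t \<Longrightarrow> t powr p * measure lebesgue {x \<in> Q. norm (f x) > t} \<le> M powr p * measure lebesgue Q"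
  shows "weak_Lp_norm p Q f \<le> ennreal M"
  unfolding weak_Lp_norm_def
proof (rule SUP_least)
  fix t :: real assume "t \<in> {0<..}"
  then have t: "0 < t" by simp
  define m where "m = measure lebesgue {x \<in> Q. norm (f x) > t} / measure lebesgue Q"
  have Q: "0 < measure lebesgue Q" by (rule is_cube_measure_pos[OF assms(2)])
  have m: "0 \<le> m" by (simp add: m_def)
  have "t powr p * m \<le> M powr p"
    using le[OF t] Q by (simp add: m_def pos_divide_le_eq)
  then have "(t powr p * m) powr (1 / p) \<le> (M powr p) powr (1 / p)"
    using m \<open>1 < p\<close> by (intro powr_mono2) auto
  then have "t * m powr (1 / p) \<le> M"
    using m t \<open>1 < p\<close> \<open>0 \<le> M\<close> by (simp add: powr_mult powr_powr)
  then show "ennreal (t * m powr (1 / p)) \<le> ennreal M" by (rule ennreal_leI)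
qed

theorem corollary4p5:
  fixes p CB :: real
  assumes "1 < p"
  shows "\<exists>C::real. 0 < C \<and>
    (\<forall>(Q0 :: (real^'n) set)
       (B :: (real^'n) set \<Rightarrow> (real^'n \<Rightarrow> 'b::{real_normed_field,banach,second_countable_topology}) \<Rightarrow> (real^'n \<Rightarrow> 'b)).
      is_cube Q0 \<longrightarrow> local_oscillation Q0 B CB \<longrightarrow>
      (\<forall>Q\<in>dyadic Q0. \<forall>f\<in>L1 Q.
         weak_Lp_norm p Q (B Q (cutoff Q f)) \<le> ennreal C * JN_norm B p Q (cutoff Q f)))"
proof -
  \<comment> \<open>The maximum with 1 ensures \<open>N \<ge> 2\<close> whatever \<open>CB\<close>
    is, so that the levels \<open>N ^ k * K\<close> increase to infinity.\<close>
  define c where "c = max 1 CB"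
  define N where "N = c * 2 ^ (CARD('n) + 1)"
  \<comment> \<open>The p-th root of the constant in
    \<open>weak_type_of_oscillation\<close>.\<close>
  define C where "C = 2 * N * (2 * good_lambda_const p N) powr (1 / p)"
  have c: "1 \<le> c" "CB \<le> c" by (auto simp: c_def)
  have N1: "1 \<le> N" using two_le_mult_power[OF c(1), of "CARD('n)"] unfolding N_def by linarith
  have D: "1 \<le> good_lambda_const p N" by (rule good_lambda_const_ge_1[OF assms N1])
  have C: "0 < C" using N1 D by (simp add: C_def)
  have C_powr: "C powr p = (2 * N) powr p * (2 * good_lambda_const p N)"
    using N1 D assms by (simp add: C_def powr_mult powr_powr)
  show ?thesis
  proof (intro exI[of _ C] conjI C allI impI ballI)
    fix Q0 :: "(real^'n) set" and B :: "(real^'n) set \<Rightarrow> (real^'n \<Rightarrow> 'b) \<Rightarrow> (real^'n \<Rightarrow> 'b)"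
      and Q and f :: "real^'n \<Rightarrow> 'b"
    assume Q0: "is_cube Q0" and loc: "local_oscillation Q0 B CB"
      and Q: "Q \<in> dyadic Q0" and f: "f \<in> L1 Q"
    define F where "F = cutoff Q f"
    define g where "g = cutoff Q (B Q F)"
    have cube: "is_cube Q" by (rule dyadic_is_cube[OF Q])
    have "integrable lebesgue F"
      using f dyadic_sets_lebesgue[OF Q] by (simp add: F_def L1_iff_integrable_cutoff)
    then have F: "F \<in> L1 Q0"
      using is_cube_lmeasurable[OF Q0] by (intro integrable_imp_L1 fmeasurableD)
    have off: "F x = 0" if "x \<notin> Q" for x using that by (simp add: F_def cutoff_def)
    have g: "integrable lebesgue g" unfolding g_def by (rule integrable_cutoff_B[OF loc Q F])
    have on: "g x = B Q F x" if "x \<in> Q" for x using that by (simp add: g_def cutoff_def)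
    have h: "set_integrable lebesgue R (B R F)" if "R \<in> dyadic Q" for R
      using integrable_cutoff_B[OF loc dyadic_trans[OF Q that] F] by (simp add: set_integrable_def cutoff_def)
    have osc: "AE x in lebesgue. x \<in> R \<longrightarrow> norm (g x) \<le> c * avg R g + norm (B R F x)" if "R \<in> dyadic Q" for R
    proof -
      have "CB * avg R g \<le> c * avg R g" using c(2) avg_nonneg by (rule mult_right_mono)
      moreover have "AE x in lebesgue. x \<in> R \<longrightarrow> norm (g x) \<le> CB * avg R g + norm (B R F x)"
        unfolding g_def by (rule oscillation_on_subcube[OF loc Q F that off])
      ultimately show ?thesis by (auto elim!: eventually_mono)
    qed
    \<comment> \<open>The levels need a positive starting value, while the JN norm may be 0; so
      \<open>K\<close> is any positive upper bound of it.\<close>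
    have weak: "weak_Lp_norm p Q (B Q F) \<le> ennreal (C * K)" if K: "0 < K" "JN_norm B p Q F \<le> ennreal K" for K
    proof (rule weak_Lp_norm_leI[OF assms cube])
      show "0 \<le> C * K" using C K by simp
      have sum_le: "(\<Sum>R\<in>T. avg R (B R F) powr p * measure lebesgue R) \<le> K powr p * measure lebesgue Q"
        if "finite T" "disjoint T" "T \<subseteq> dyadic Q" for T
        using JN_norm_finite_sum_le[OF assms _ cube K(2) that] K(1) by simp
      have "avg Q g = avg Q (B Q F)"
        unfolding avg_def using on by (intro arg_cong2[of _ _ _ _ "(*)"] refl Bochner_Integration.integral_cong) auto
      \<comment> \<open>The one-member family \<open>{Q}\<close> turns the JN bound into a bound for
        the average over \<open>Q\<close>, the starting condition of the iteration.\<close>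
      moreover have "avg Q (B Q F) powr p \<le> K powr p"
        using sum_le[of "{Q}"] dyadic_self[OF cube] is_cube_measure_pos[OF cube] by (simp add: disjoint_def)
      then have "avg Q (B Q F) \<le> K"
        using assms K(1) by (metis avg_nonneg not_le order_less_imp_le powr_less_mono2 zero_less_one order_less_trans)
      ultimately have avg_Q: "avg Q g \<le> K" by simp
      fix t :: real assume t: "0 < t"
      have "{x \<in> Q. norm (B Q F x) > t} = {x \<in> Q. norm (g x) > t}" using on by auto
      then show "t powr p * measure lebesgue {x \<in> Q. norm (B Q F x) > t} \<le> (C * K) powr p * measure lebesgue Q"
        using weak_type_of_oscillation[OF assms K(1) cube g h osc c(1) N_def avg_Q sum_le t] C K(1)
        by (simp add: powr_mult C_powr mult_ac)
    qed
    have "weak_Lp_norm p Q (B Q F) \<le> ennreal C * JN_norm B p Q F"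
    proof (cases "JN_norm B p Q F" rule: ennreal_cases)
      case (real j)
      show ?thesis
      \<comment> \<open>The bound \<open>K = j + e / C\<close> is positive even for
        \<open>j = 0\<close>, and its excess over \<open>j\<close> costs exactly \<open>e\<close>
        after multiplication by \<open>C\<close>.\<close>
      proof (rule ennreal_le_epsilon)
        fix e :: real assume e: "0 < e"
        have "weak_Lp_norm p Q (B Q F) \<le> ennreal (C * (j + e / C))"
          using C e real by (intro weak) (auto intro!: add_nonneg_pos ennreal_leI)
        also have "C * (j + e / C) = C * j + e" using C by (simp add: distrib_left)
        also have "ennreal (C * j + e) = ennreal C * JN_norm B p Q F + ennreal e"
          using C e real by (simp add: ennreal_plus ennreal_mult)
        finally show "weak_Lp_norm p Q (B Q F) \<le> ennreal C * JN_norm B p Q F + ennreal e" .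
      qed
    next
      case top
      then show ?thesis using C by (simp add: ennreal_mult_top)
    qed
    then show "weak_Lp_norm p Q (B Q (cutoff Q f)) \<le> ennreal C * JN_norm B p Q (cutoff Q f)"
      unfolding F_def .
  qed
qed

end
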